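(* Let $f,g:\mathbb{R}^2\to\mathbb{R}$ and consider the system $$\partial_t u+\partial_x f(u,v)=0,\qquad \partial_t v+\partial_x g(u,v)=0 \qquad (x\in\mathbb{R},\ t>0)$$ with Riemann initial data $u(x,0)=U_0(x)$, $v(x,0)=V_0(x)$, where for real constants $u_1,u_2,v_1,v_2$ $$U_0(x)=\begin{cases}u_1,&x<0,\\ u_2,&x>0,\end{cases}\qquad V_0(x)=\begin{cases}v_1,&x<0,\\ v_2,&x>0.\end{cases}$$ Write $[U]=u_2-u_1$, $[V]=v_2-v_1$, $[f(U,V)]=f(u_2,v_2)-f(u_1,v_1)$, $[g(U,V)]=g(u_2,v_2)-g(u_1,v_1)$. (a) If $u_1\neq u_2$, then the pair of distributions $$u(x,t)=U_0(x-ct),\qquad v(x,t)=V_0(x-ct)+\beta(t)\,\delta(x-ct),$$ where $$c=\frac{[f(U,V)]}{[U]}=\frac{f(u_2,v_2)-f(u_1,v_1)}{u_2-u_1},\qquad \beta(t)=\big(c[V]-[g(U,V)]\big)t,$$ is a generalized $\delta$-shock wave solution of the system with initial data $U_0,V_0$ (with $\alpha(t)=0$). (b) If $v_1\neq v_2$, then the pair of distributions $$u(x,t)=U_0(x-ct)+\alpha(t)\,\delta(x-ct),\qquad v(x,t)=V_0(x-ct),$$ where $$c=\frac{[g(U,V)]}{[V]}=\frac{g(u_2,v_2)-g(u_1,v_1)}{v_2-v_1},\qquad \alpha(t)=\big(c[U]-[f(U,V)]\big)t,$$ is a generalized $\delta$-shock wave solution of the system with initial data $U_0,V_0$ (with 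$\beta(t)=0$).
   Context: Definition (generalized $\delta$-shock wave solution). Let $\Gamma=\{\gamma_i: i\in I\}$, $I$ finite, be a family of Lipschitz arcs in the closed half plane $\{(x,t): t\ge 0\}$, let $U,V$ be bounded measurable functions on $\mathbb{R}\times\mathbb{R}_+$, where $\mathbb{R}_+=[0,\infty)$, and let $\alpha_i,\beta_i$ be continuous functions on $\gamma_i$. Write $\alpha(x,t)\delta(\Gamma)=\sum_{i\in I}\alpha_i(x,t)\delta(\gamma_i)$ and $\beta(x,t)\delta(\Gamma)=\sum_{i\in I}\beta_i(x,t)\delta(\gamma_i)$. The pair of distributions $$u=U+\alpha(x,t)\delta(\Gamma),\qquad v=V+\beta(x,t)\delta(\Gamma)$$ is called a generalized $\delta$-shock wave solution of $\partial_t u+\partial_x f(u,v)=0$, $\partial_t v+\partial_x g(u,v)=0$ with initial data $U_0(x),V_0(x)$ if $$\int_{\mathbb{R}_+}\!\int_{\mathbb{R}}\big(U\,\partial_t\varphi+f(U,V)\,\partial_x\varphi\big)\,dx\,dt+\sum_{i\in I}\int_{\gamma_i}\alpha_i(x,t)\frac{\partial\varphi(x,t)}{\partial\mathbf{l}}+\int_{\mathbb{R}}U_0(x)\varphi(x,0)\,dx=0,$$ $$\int_{\mathbb{R}_+}\!\int_{\mathbb{R}}\big(V\,\partial_t\varphi+g(U,V)\,\partial_x\varphi\big)\,dx\,dt+\sum_{i\in I}\int_{\gamma_i}\beta_i(x,t)\frac{\partial\varphi(x,t)}{\partial\mathbf{l}}+\int_{\mathbb{R}}V_0(x)\varphi(x,0)\,dx=0$$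 for all test functions $\varphi\in\mathcal{D}(\mathbb{R}\times\mathbb{R}_+)$, i.e. smooth and compactly supported in $\mathbb{R}\times[0,\infty)$ (not required to vanish at $t=0$). Here $\partial\varphi/\partial\mathbf{l}$ is the tangential derivative of $\varphi$ along $\gamma_i$, and $\int_{\gamma_i}$ is the line integral; thus for $\gamma=\{(ct,t):t\ge0\}$ and a coefficient $\beta(t)$, the term equals $\int_0^\infty\beta(t)\,\frac{d}{dt}\big[\varphi(ct,t)\big]\,dt$. The notation $\beta(t)\delta(x-ct)$ means $\beta\,\delta(\gamma)$ for this line $\gamma$. *)

theory Defs
  imports "HOL-Analysis.Analysis"
begin

(* Points of the plane are pairs (x, t): space first, time second. *)

definition half_plane :: "(real \<times> real) set" where
  "half_plane = UNIV \<times> {0..}"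


section \<open>Test functions\<close>

(* Smoothness up to the boundary t = 0: all derivatives are taken within the closed set S, so
   for S = half_plane they are one-sided in t on the boundary and the values of phi for t < 0
   play no role. *)
primrec times_cont_diff_on :: "nat \<Rightarrow> (real \<times> real) set \<Rightarrow> (real \<times> real \<Rightarrow> real) \<Rightarrow> bool" where
  "times_cont_diff_on 0 S \<phi> \<longleftrightarrow> continuous_on S \<phi>"
| "times_cont_diff_on (Suc k) S \<phi> \<longleftrightarrow>
     (\<exists>\<phi>x \<phi>t. (\<forall>p\<in>S. (\<phi> has_derivative (\<lambda>h. fst h * \<phi>x p + snd h * \<phi>t p)) (at p within S)) \<and>
        times_cont_diff_on k S \<phi>x \<and> times_cont_diff_on k S \<phi>t)"

definition test_function :: "(real \<times> real \<Rightarrow> real) \<Rightarrow> bool" where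
  "test_function \<phi> \<longleftrightarrow>
     (\<forall>k. times_cont_diff_on k half_plane \<phi>) \<and>
     (\<exists>K. compact K \<and> K \<subseteq> half_plane \<and> (\<forall>p\<in>half_plane - K. \<phi> p = 0))"

definition pd_x :: "(real \<times> real \<Rightarrow> real) \<Rightarrow> real \<times> real \<Rightarrow> real" where
  "pd_x \<phi> p = frechet_derivative \<phi> (at p within half_plane) (1, 0)"

definition pd_t :: "(real \<times> real \<Rightarrow> real) \<Rightarrow> real \<times> real \<Rightarrow> real" where
  "pd_t \<phi> p = frechet_derivative \<phi> (at p within half_plane) (0, 1)"


section \<open>Lipschitz arcs and line integrals\<close>

(* An arc is given by a Lipschitz parametrization \<gamma> on an interval T, which need not be bounded;
   the parametrization also fixes the orientation. *)
definition lipschitz_arc :: "real set \<Rightarrow> (real \<Rightarrow> real \<times> real) \<Rightarrow> bool" where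
  "lipschitz_arc T \<gamma> \<longleftrightarrow>
     is_interval T \<and> interior T \<noteq> {} \<and> \<gamma> ` T \<subseteq> half_plane \<and>
     (\<exists>L. L-lipschitz_on T \<gamma>) \<and> (\<exists>\<gamma>'. homeomorphism T (\<gamma> ` T) \<gamma> \<gamma>')"

definition velocity :: "real set \<Rightarrow> (real \<Rightarrow> real \<times> real) \<Rightarrow> real \<Rightarrow> real \<times> real" where
  "velocity T \<gamma> s = vector_derivative \<gamma> (at s within T)"

(* Derivative of \<phi> in the direction of the unit tangent sgn (velocity T \<gamma> s) at the point \<gamma> s.
   It is meaningful for almost every s, as Lipschitz curves are differentiable almost everywhere;
   where the velocity vanishes its value does not matter for line integrals. *)
definition tangential_derivative ::
    "real set \<Rightarrow> (real \<Rightarrow> real \<times> real) \<Rightarrow> (real \<times> real \<Rightarrow> real) \<Rightarrow> real \<Rightarrow> real" where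
  "tangential_derivative T \<gamma> \<phi> s =
     frechet_derivative \<phi> (at (\<gamma> s) within half_plane) (sgn (velocity T \<gamma> s))"

(* Integration with respect to arc length; h is a function of the parameter. *)
definition line_integrable :: "real set \<Rightarrow> (real \<Rightarrow> real \<times> real) \<Rightarrow> (real \<Rightarrow> real) \<Rightarrow> bool" where
  "line_integrable T \<gamma> h \<longleftrightarrow> set_integrable lebesgue T (\<lambda>s. h s * norm (velocity T \<gamma> s))"

definition line_integral :: "real set \<Rightarrow> (real \<Rightarrow> real \<times> real) \<Rightarrow> (real \<Rightarrow> real) \<Rightarrow> real" where
  "line_integral T \<gamma> h = (LINT s:T|lebesgue. h s * norm (velocity T \<gamma> s))"


section \<open>Generalized delta-shock wave solutions\<close>

(* The integral identity for one conservation law with density W + \<Sum> \<kappa>_i \<delta>(\<gamma>_i), flux F and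
   initial data W0, tested against \<phi>.  The integrals in it are required to exist, since Isabelle's
   integral of a non-integrable function is 0. *)
definition weak_identity ::
    "'i set \<Rightarrow> ('i \<Rightarrow> real set) \<Rightarrow> ('i \<Rightarrow> real \<Rightarrow> real \<times> real) \<Rightarrow>
     (real \<times> real \<Rightarrow> real) \<Rightarrow> (real \<times> real \<Rightarrow> real) \<Rightarrow> ('i \<Rightarrow> real \<times> real \<Rightarrow> real) \<Rightarrow>
     (real \<Rightarrow> real) \<Rightarrow> (real \<times> real \<Rightarrow> real) \<Rightarrow> bool" where
  "weak_identity I T \<gamma> W F \<kappa> W0 \<phi> \<longleftrightarrow>
     set_integrable lebesgue half_plane (\<lambda>p. W p * pd_t \<phi> p + F p * pd_x \<phi> p) \<and>
     (\<forall>i\<in>I. line_integrable (T i) (\<gamma> i)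
              (\<lambda>s. \<kappa> i (\<gamma> i s) * tangential_derivative (T i) (\<gamma> i) \<phi> s)) \<and>
     integrable lebesgue (\<lambda>x. W0 x * \<phi> (x, 0)) \<and>
     (LINT t:{0..}|lebesgue. LINT x|lebesgue.
         W (x, t) * pd_t \<phi> (x, t) + F (x, t) * pd_x \<phi> (x, t)) +
     (\<Sum>i\<in>I. line_integral (T i) (\<gamma> i)
              (\<lambda>s. \<kappa> i (\<gamma> i s) * tangential_derivative (T i) (\<gamma> i) \<phi> s)) +
     (LINT x|lebesgue. W0 x * \<phi> (x, 0)) = 0"

(* The pair u = U + \<Sum>i\<in>I. \<alpha>_i \<delta>(\<gamma>_i), v = V + \<Sum>i\<in>I. \<beta>_i \<delta>(\<gamma>_i) is given by its components
   U, \<alpha>, V, \<beta> and the arcs (T i, \<gamma> i). *)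
definition generalized_delta_shock ::
    "(real \<times> real \<Rightarrow> real) \<Rightarrow> (real \<times> real \<Rightarrow> real) \<Rightarrow> (real \<Rightarrow> real) \<Rightarrow> (real \<Rightarrow> real) \<Rightarrow>
     'i set \<Rightarrow> ('i \<Rightarrow> real set) \<Rightarrow> ('i \<Rightarrow> real \<Rightarrow> real \<times> real) \<Rightarrow>
     (real \<times> real \<Rightarrow> real) \<Rightarrow> ('i \<Rightarrow> real \<times> real \<Rightarrow> real) \<Rightarrow>
     (real \<times> real \<Rightarrow> real) \<Rightarrow> ('i \<Rightarrow> real \<times> real \<Rightarrow> real) \<Rightarrow> bool" where
  "generalized_delta_shock f g U0 V0 I T \<gamma> U \<alpha> V \<beta> \<longleftrightarrow>
     finite I \<and> (\<forall>i\<in>I. lipschitz_arc (T i) (\<gamma> i)) \<and>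
     U \<in> borel_measurable (lebesgue_on half_plane) \<and> bounded (U ` half_plane) \<and>
     V \<in> borel_measurable (lebesgue_on half_plane) \<and> bounded (V ` half_plane) \<and>
     (\<forall>i\<in>I. continuous_on (\<gamma> i ` T i) (\<alpha> i) \<and> continuous_on (\<gamma> i ` T i) (\<beta> i)) \<and>
     (\<forall>\<phi>. test_function \<phi> \<longrightarrow>
        weak_identity I T \<gamma> U (\<lambda>p. f (U p, V p)) \<alpha> U0 \<phi> \<and>
        weak_identity I T \<gamma> V (\<lambda>p. g (U p, V p)) \<beta> V0 \<phi>)"

(* The case where the singular parts are supported on the single line x = c t, t \<ge> 0, with
   coefficients depending on t:
   u = U + \<alpha>(t) \<delta>(x - c t), v = V + \<beta>(t) \<delta>(x - c t). *)
definition generalized_delta_shock_on_line ::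
    "(real \<times> real \<Rightarrow> real) \<Rightarrow> (real \<times> real \<Rightarrow> real) \<Rightarrow> (real \<Rightarrow> real) \<Rightarrow> (real \<Rightarrow> real) \<Rightarrow> real \<Rightarrow>
     (real \<times> real \<Rightarrow> real) \<Rightarrow> (real \<Rightarrow> real) \<Rightarrow> (real \<times> real \<Rightarrow> real) \<Rightarrow> (real \<Rightarrow> real) \<Rightarrow> bool" where
  "generalized_delta_shock_on_line f g U0 V0 c U \<alpha> V \<beta> \<longleftrightarrow>
     generalized_delta_shock f g U0 V0 {()} (\<lambda>_. {0..}) (\<lambda>_ t. (c * t, t))
       U (\<lambda>_ (x, t). \<alpha> t) V (\<lambda>_ (x, t). \<beta> t)"

end

theory Submission
  imports Defs
begin

text \<open>
  The singular part repairs the Rankine-Hugoniot condition. Consider one conservation law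
  \<open>W\<^sub>t + F\<^sub>x = 0\<close> and a step travelling at speed \<open>c\<close>, so that density and flux are functions
  \<open>W0\<close>, \<open>F0\<close> of \<open>y = x - c t\<close>, constant on either side of \<open>y = 0\<close>. The step alone violates the
  weak form by \<open>(c [W] - [F]) \<integral> \<phi>(c t, t) dt\<close>. A delta function on the line \<open>x = c t\<close> with
  coefficient \<open>\<kappa>(t)\<close> contributes \<open>\<integral> \<kappa>(t) d/dt \<phi>(c t, t) dt\<close>, which for \<open>\<kappa>(t) = k t\<close> equals
  \<open>- k \<integral> \<phi>(c t, t) dt\<close> after integration by parts. Hence \<open>k = c [W] - [F]\<close> cancels the
  defect, whatever the speed \<open>c\<close> is. This is \<open>delta_shock_every_speed\<close>, where both components
  carry a delta function; the theorem follows because the Rankine-Hugoniot speed of one of the two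
  equations makes its own coefficient vanish.

  The defect is computed in the moving coordinate \<open>y\<close>. With
  \<open>D(y, t) = d/dt \<phi>(y + c t, t) = \<phi>\<^sub>t + c \<phi>\<^sub>x\<close>, the integrand \<open>W \<phi>\<^sub>t + F \<phi>\<^sub>x\<close> at
  \<open>(y + c t, t)\<close> becomes
  \<open>W0(y) D(y, t) + (F0(y) - c W0(y)) \<phi>\<^sub>x(y + c t, t)\<close>.
  The second summand is an \<open>x\<close>-derivative times a step function and integrates over \<open>y\<close> to the jump
  term (\<open>slice_integral\<close>). The first one, after Fubini, is integrated over \<open>t\<close> first and yields
  \<open>- \<integral> W0(y) \<phi>(y, 0) dy\<close>, which the initial data cancel (\<open>transport_integral\<close>). Working along
  the lines \<open>y = const\<close>, parallel to the shock, avoids differentiating an integral with moving endpoints.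
\<close>
section \<open>Step functions with one jump\<close>

text \<open>
  The value at the jump is left open, as the Riemann data do not prescribe it.
\<close>

definition two_state :: "(real \<Rightarrow> real) \<Rightarrow> real \<Rightarrow> real \<Rightarrow> bool" where
  "two_state s a b \<longleftrightarrow> (\<forall>y<0. s y = a) \<and> (\<forall>y>0. s y = b)"

lemma two_state_cases:
  assumes "two_state s a b"
  shows "s = (\<lambda>y. if y < 0 then a else if y > 0 then b else s 0)"
proof
  fix y :: real
  show "s y = (if y < 0 then a else if y > 0 then b else s 0)"
    using assms unfolding two_state_def by (cases y "0::real" rule: linorder_cases) auto
qed

lemma two_state_borel_measurable:
  assumes "two_state s a b"
  shows "s \<in> borel_measurable borel"
  by (subst two_state_cases[OF assms]) measurable

lemma two_state_bounded:
  assumes "two_state s a b"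
  shows "bounded (range s)"
proof -
  have "range s \<subseteq> {a, b, s 0}"
    by (subst two_state_cases[OF assms]) auto
  then show ?thesis
    by (metis bounded_subset finite.emptyI finite_imp_bounded finite.insertI)
qed

text \<open>
  Measurability and boundedness of \<open>f(U, V)\<close> come from here: a function of two step functions is
  again a step function, however irregular the flux \<open>f\<close> is.
\<close>

lemma two_state_comp2:
  assumes "two_state r a b" "two_state s a' b'"
  shows "two_state (\<lambda>y. h (r y, s y)) (h (a, a')) (h (b, b'))"
  using assms unfolding two_state_def by simp

text \<open>
  The relative flux, seen by an observer moving at speed \<open>c\<close>.
\<close>

lemma two_state_diff_scaled:
  assumes "two_state r a b" "two_state s a' b'"
  shows "two_state (\<lambda>y. s y - c * r y) (a' - c * a) (b' - c * b)"
  using assms unfolding two_state_def by simp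

lemma travelling_wave_borel_measurable:
  assumes "two_state s a b"
  shows "(\<lambda>p. s (fst p - c * snd p)) \<in> borel_measurable (borel :: (real \<times> real) measure)"
  by (rule measurable_compose[OF _ two_state_borel_measurable[OF assms]])
     (intro borel_measurable_continuous_onI continuous_intros)

lemma travelling_wave_bounded:
  assumes "two_state s a b"
  shows "bounded (range (\<lambda>p :: real \<times> real. s (fst p - c * snd p)))"
  by (rule bounded_subset[OF two_state_bounded[OF assms]]) auto

section \<open>Continuous functions on the half plane that vanish far out\<close>

lemma in_half_plane [simp]: "(x, t) \<in> half_plane \<longleftrightarrow> 0 \<le> t"
  by (simp add: half_plane_def)

lemma half_plane_borel [measurable]: "half_plane \<in> sets borel"
  unfolding half_plane_def by (intro borel_closed closed_Times) auto

text \<open>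
  Compact support in the form of an explicit box \<open>[-R, R] \<times> [0, R]\<close>, outside of which the function
  vanishes: this makes every slice integral an integral over an interval with known endpoints.
  Nothing is said about \<open>t < 0\<close>, where test functions are arbitrary.
\<close>

definition cont_vanishing_beyond :: "real \<Rightarrow> (real \<times> real \<Rightarrow> real) \<Rightarrow> bool" where
  "cont_vanishing_beyond R q \<longleftrightarrow> 0 \<le> R \<and> continuous_on half_plane q \<and>
     (\<forall>x t. 0 \<le> t \<and> (R \<le> \<bar>x\<bar> \<or> R \<le> t) \<longrightarrow> q (x, t) = 0)"

text \<open>
  While \<open>t < R\<close>, passing to the moving coordinate displaces points by at most \<open>\<bar>c\<bar> R\<close>.
\<close>

lemma cont_vanishing_beyond_shift:
  assumes "cont_vanishing_beyond R q"
  shows "cont_vanishing_beyond (R + \<bar>c\<bar> * R) (\<lambda>(y, t). q (y + c * t, t))"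
  unfolding cont_vanishing_beyond_def
proof (intro conjI allI impI)
  show "0 \<le> R + \<bar>c\<bar> * R"
    using assms by (simp add: cont_vanishing_beyond_def)
  have "continuous_on half_plane (\<lambda>p. q (fst p + c * snd p, snd p))"
    by (rule continuous_on_compose2[of half_plane q])
       (use assms in \<open>auto simp: cont_vanishing_beyond_def half_plane_def intro!: continuous_intros\<close>)
  then show "continuous_on half_plane (\<lambda>(y, t). q (y + c * t, t))"
    by (simp add: case_prod_unfold)
  fix y t :: real
  assume *: "0 \<le> t \<and> (R + \<bar>c\<bar> * R \<le> \<bar>y\<bar> \<or> R + \<bar>c\<bar> * R \<le> t)"
  have R: "0 \<le> R" "R \<le> R + \<bar>c\<bar> * R"
    using assms by (auto simp: cont_vanishing_beyond_def)
  have "R \<le> \<bar>y + c * t\<bar>" if "t < R"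
  proof -
    have "\<bar>c * t\<bar> \<le> \<bar>c\<bar> * R"
      using that * by (simp add: abs_mult mult_left_mono)
    moreover have "R + \<bar>c\<bar> * R \<le> \<bar>y\<bar>" using * that R by linarith
    ultimately show ?thesis by linarith
  qed
  then have "q (y + c * t, t) = 0"
    using assms * unfolding cont_vanishing_beyond_def by (meson not_le)
  then show "(case (y, t) of (y, t) \<Rightarrow> q (y + c * t, t)) = 0" by simp
qed

lemma cont_vanishing_beyond_along_line:
  assumes "cont_vanishing_beyond R q"
  shows "continuous_on {0..} (\<lambda>t. q (y + c * t, t))"
  by (rule continuous_on_compose2[of half_plane q])
     (use assms in \<open>auto simp: cont_vanishing_beyond_def intro!: continuous_intros\<close>)

lemma cont_vanishing_beyond_in_space:
  assumes "cont_vanishing_beyond R q" "0 \<le> t"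
  shows "continuous_on UNIV (\<lambda>y. q (y + a, t))"
  by (rule continuous_on_compose2[of half_plane q])
     (use assms in \<open>auto simp: cont_vanishing_beyond_def intro!: continuous_intros\<close>)

section \<open>Integrability and one-dimensional integrals of derivatives\<close>

lemma has_bochner_integral_lebesgueI:
  fixes h :: "real \<Rightarrow> real"
  assumes "has_bochner_integral lborel h r"
  shows "has_bochner_integral lebesgue h r"
  using assms
  by (auto simp: has_bochner_integral_iff integrable_completion integral_completion)

lemma integrable_bounded_times:
  fixes q w :: "'a \<Rightarrow> real"
  assumes q: "integrable M q" and w: "w \<in> borel_measurable M" and bd: "bounded (range w)"
  shows "integrable M (\<lambda>p. w p * q p)"
proof -
  obtain B where B: "\<And>p. \<bar>w p\<bar> \<le> B"
    using bd by (auto simp: bounded_iff)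
  then have "0 \<le> B" using abs_ge_zero order_trans by blast
  have "integrable M (\<lambda>p. B * q p)"
    using q by simp
  then show ?thesis
  proof (rule Bochner_Integration.integrable_bound)
    show "(\<lambda>p. w p * q p) \<in> borel_measurable M"
      using q w by simp
    show "AE p in M. norm (w p * q p) \<le> norm (B * q p)"
      using B \<open>0 \<le> B\<close> by (intro AE_I2) (simp add: abs_mult mult_right_mono)
  qed
qed

lemma two_state_integrable:
  assumes s: "two_state s a b"
    and cont: "continuous_on UNIV \<psi>" and van: "\<And>y. R \<le> \<bar>y\<bar> \<Longrightarrow> \<psi> y = 0"
  shows "integrable lborel (\<lambda>y. s y * \<psi> y)"
proof -
  have "integrable lborel (\<lambda>y. indicator {-R..R} y *\<^sub>R \<psi> y)"
    by (intro borel_integrable_compact continuous_on_subset[OF cont]) auto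
  moreover have "(\<lambda>y. indicator {-R..R} y *\<^sub>R \<psi> y) = \<psi>"
  proof
    show "indicator {-R..R} y *\<^sub>R \<psi> y = \<psi> y" for y
      using van[of y] by (cases "R \<le> \<bar>y\<bar>") (auto simp: indicator_def)
  qed
  ultimately have "integrable lborel \<psi>" by simp
  then show ?thesis
    by (rule integrable_bounded_times)
       (use two_state_borel_measurable[OF s] two_state_bounded[OF s] in auto)
qed

lemma cont_vanishing_beyond_integrable:
  assumes q: "cont_vanishing_beyond R q"
    and w: "w \<in> borel_measurable borel" and bd: "bounded (range w)"
  shows "integrable lborel (\<lambda>p. indicator half_plane p * (w p * q p) :: real)"
proof -
  define S where "S = {-R..R} \<times> {0..R}"
  have S: "compact S" "S \<subseteq> half_plane"
    unfolding S_def half_plane_def by (auto intro: compact_Times)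
  have q0: "indicator half_plane p * q p = indicator S p * q p" for p :: "real \<times> real"
    using q by (cases p) (auto simp: cont_vanishing_beyond_def S_def half_plane_def indicator_def)
  have "continuous_on S q"
    using q S(2) continuous_on_subset unfolding cont_vanishing_beyond_def by blast
  from borel_integrable_compact[OF S(1) this]
  have int: "integrable lborel (\<lambda>p. indicator half_plane p * q p)"
    by (simp add: q0)
  from integrable_bounded_times[OF this _ bd] w show ?thesis
    by (simp add: mult_ac)
qed

lemma cont_vanishing_beyond_integrable_along_line:
  assumes q: "cont_vanishing_beyond R q"
  shows "integrable lborel (\<lambda>t. indicator {0..} t * q (c * t, t))"
proof -
  have c: "continuous_on {0..R} (\<lambda>t. q (c * t, t))"
    using continuous_on_subset[OF cont_vanishing_beyond_along_line[OF q, of 0 c], of "{0..R}"]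
    by simp
  have "integrable lborel (\<lambda>t. indicator {0..R} t *\<^sub>R q (c * t, t))"
    by (rule borel_integrable_compact[OF _ c]) simp
  moreover have "(\<lambda>t. indicator {0..R} t *\<^sub>R q (c * t, t)) = (\<lambda>t. indicator {0..} t * q (c * t, t))"
    using q by (auto simp: indicator_def fun_eq_iff cont_vanishing_beyond_def)
  ultimately show ?thesis by simp
qed

text \<open>
  The fundamental theorem of calculus on \<open>[-R, 0]\<close> and on \<open>[0, R]\<close>: only the contributions at the
  jump survive.
\<close>

lemma two_state_integral_deriv:
  assumes s: "two_state s a b" and R: "0 \<le> R"
    and der: "\<And>y. (\<psi> has_real_derivative \<psi>' y) (at y)"
    and cont: "continuous_on UNIV \<psi>'"
    and van: "\<And>y. R \<le> \<bar>y\<bar> \<Longrightarrow> \<psi> y = 0 \<and> \<psi>' y = 0"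
  shows "has_bochner_integral lborel (\<lambda>y. s y * \<psi>' y) ((a - b) * \<psi> 0)"
proof -
  have der': "(\<psi> has_vector_derivative \<psi>' y) (at y within A)" for y A
    using der[of y] has_vector_derivative_at_within
      has_real_derivative_iff_has_vector_derivative by blast
  have left: "has_bochner_integral lborel (\<lambda>y. indicator {-R..0} y *\<^sub>R \<psi>' y) (\<psi> 0 - \<psi> (-R))"
    using R der' by (intro has_bochner_integral_FTC_Icc continuous_on_subset[OF cont]) auto
  have right: "has_bochner_integral lborel (\<lambda>y. indicator {0..R} y *\<^sub>R \<psi>' y) (\<psi> R - \<psi> 0)"
    using R der' by (intro has_bochner_integral_FTC_Icc continuous_on_subset[OF cont]) auto
  have ends: "\<psi> R = 0" "\<psi> (-R) = 0" using van R by auto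
  let ?h = "\<lambda>y. a * (indicator {-R..0} y *\<^sub>R \<psi>' y) + b * (indicator {0..R} y *\<^sub>R \<psi>' y)"
  have "has_bochner_integral lborel ?h (a * (\<psi> 0 - \<psi> (-R)) + b * (\<psi> R - \<psi> 0))"
    by (intro has_bochner_integral_add has_bochner_integral_mult_right left right)
  then have h: "has_bochner_integral lborel ?h ((a - b) * \<psi> 0)"
    by (simp add: ends algebra_simps)
  have "has_bochner_integral lborel (\<lambda>y. s y * \<psi>' y) ((a - b) * \<psi> 0)
        \<longleftrightarrow> has_bochner_integral lborel ?h ((a - b) * \<psi> 0)"
  proof (rule has_bochner_integral_cong_AE)
    have "\<psi>' \<in> borel_measurable borel"
      using cont borel_measurable_continuous_onI by blast
    then show "(\<lambda>y. s y * \<psi>' y) \<in> borel_measurable lborel"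
      using two_state_borel_measurable[OF s] by simp
    show "?h \<in> borel_measurable lborel"
      using h by auto
    \<comment> \<open>The two sides may differ only at the jump.\<close>
    have "s y * \<psi>' y = ?h y" if "y \<noteq> 0" for y
      using that s van[of y] R unfolding two_state_def indicator_def
      by (cases "R \<le> \<bar>y\<bar>"; cases "y < 0") auto
    then show "AE y in lborel. s y * \<psi>' y = ?h y"
      using AE_lborel_singleton[of "0::real"] by (auto elim: eventually_mono)
  qed
  with h show ?thesis by simp
qed

lemma half_line_integral_deriv:
  assumes R: "0 \<le> R"
    and der: "\<And>t. 0 \<le> t \<Longrightarrow> (\<theta> has_real_derivative \<theta>' t) (at t within {0..})"
    and cont: "continuous_on {0..} \<theta>'"
    and van: "\<And>t. R \<le> t \<Longrightarrow> \<theta> t = 0 \<and> \<theta>' t = 0"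
  shows "has_bochner_integral lborel (\<lambda>t. indicator {0..} t * \<theta>' t) (- \<theta> 0)"
proof -
  have "has_bochner_integral lborel (\<lambda>t. indicator {0..R} t *\<^sub>R \<theta>' t) (\<theta> R - \<theta> 0)"
  proof (rule has_bochner_integral_FTC_Icc[OF R])
    show "(\<theta> has_vector_derivative \<theta>' t) (at t within {0..R})" if "0 \<le> t" "t \<le> R" for t
      using der[OF that(1)]
      by (auto simp: has_real_derivative_iff_has_vector_derivative
          intro: has_vector_derivative_within_subset)
    show "continuous_on {0..R} \<theta>'"
      by (rule continuous_on_subset[OF cont]) auto
  qed
  moreover have "(\<lambda>t. indicator {0..R} t *\<^sub>R \<theta>' t) = (\<lambda>t. indicator {0..} t * \<theta>' t)"
    using van by (auto simp: indicator_def fun_eq_iff)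
  ultimately show ?thesis using van[of R] by simp
qed

section \<open>Partial derivatives of test functions\<close>

text \<open>
  From each point of the closed half plane one can move in the positive direction of both axes
  without leaving it, which determines the derivative within it even on the boundary \<open>t = 0\<close>.
\<close>

lemma half_plane_has_derivative_unique:
  assumes p: "p \<in> half_plane"
    and "(\<phi> has_derivative D) (at p within half_plane)"
    and "(\<phi> has_derivative D') (at p within half_plane)"
  shows "D = D'"
proof (rule frechet_derivative_unique_within[OF assms(2,3)])
  fix i :: "real \<times> real" and e :: real
  assume i: "i \<in> Basis" and e: "e > 0"
  have "0 \<le> snd i" using i by (auto simp: Basis_prod_def)
  then have "p + (e / 2) *\<^sub>R i \<in> half_plane"
    using p e by (cases p; cases i) (auto simp: half_plane_def)
  then show "\<exists>d. 0 < \<bar>d\<bar> \<and> \<bar>d\<bar> < e \<and> p + d *\<^sub>R i \<in> half_plane"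
    using e by (intro exI[of _ "e / 2"]) auto
qed

lemma pd_eqI:
  assumes "p \<in> half_plane"
    and D: "(\<phi> has_derivative (\<lambda>h. fst h * a + snd h * b)) (at p within half_plane)"
  shows "pd_x \<phi> p = a" "pd_t \<phi> p = b"
proof -
  have "(\<phi> has_derivative frechet_derivative \<phi> (at p within half_plane)) (at p within half_plane)"
    using D frechet_derivative_works differentiable_def by blast
  from half_plane_has_derivative_unique[OF assms(1) this D]
  have "frechet_derivative \<phi> (at p within half_plane) = (\<lambda>h. fst h * a + snd h * b)" .
  then show "pd_x \<phi> p = a" "pd_t \<phi> p = b"
    by (simp_all add: pd_x_def pd_t_def)
qed

lemma test_function_has_derivative:
  assumes "test_function \<phi>" "p \<in> half_plane"
  shows "(\<phi> has_derivative (\<lambda>h. fst h * pd_x \<phi> p + snd h * pd_t \<phi> p)) (at p within half_plane)"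
proof -
  from assms(1) have "times_cont_diff_on 1 half_plane \<phi>"
    by (simp add: test_function_def)
  then obtain \<phi>x \<phi>t where
    "\<forall>p\<in>half_plane. (\<phi> has_derivative (\<lambda>h. fst h * \<phi>x p + snd h * \<phi>t p)) (at p within half_plane)"
    by auto
  then have "(\<phi> has_derivative (\<lambda>h. fst h * \<phi>x p + snd h * \<phi>t p)) (at p within half_plane)"
    using assms(2) by blast
  with pd_eqI[OF assms(2) this] show ?thesis by simp
qed

lemma test_function_cont_pd:
  assumes "test_function \<phi>"
  shows "continuous_on half_plane \<phi>" "continuous_on half_plane (pd_x \<phi>)"
    "continuous_on half_plane (pd_t \<phi>)"
proof -
  from assms have "times_cont_diff_on 0 half_plane \<phi>" "times_cont_diff_on 1 half_plane \<phi>"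
    unfolding test_function_def by blast+
  then obtain \<phi>x \<phi>t where
    D: "\<forall>p\<in>half_plane. (\<phi> has_derivative (\<lambda>h. fst h * \<phi>x p + snd h * \<phi>t p)) (at p within half_plane)"
    and c: "continuous_on half_plane \<phi>" "continuous_on half_plane \<phi>x" "continuous_on half_plane \<phi>t"
    by auto
  have "\<And>p. p \<in> half_plane \<Longrightarrow> pd_x \<phi> p = \<phi>x p \<and> pd_t \<phi> p = \<phi>t p"
    using D pd_eqI by blast
  with c show "continuous_on half_plane \<phi>" "continuous_on half_plane (pd_x \<phi>)"
    "continuous_on half_plane (pd_t \<phi>)"
    by (simp_all cong: continuous_on_cong)
qed

text \<open>
  The zero set contains a relatively open neighbourhood of each point outside the support, so the
  partial derivatives vanish there as well.
\<close>

lemma test_function_vanishing_beyond: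
  assumes "test_function \<phi>"
  obtains R where "cont_vanishing_beyond R \<phi>" "cont_vanishing_beyond R (pd_x \<phi>)"
    "cont_vanishing_beyond R (pd_t \<phi>)"
proof -
  obtain K where K: "compact K" "\<And>p. p \<in> half_plane - K \<Longrightarrow> \<phi> p = 0"
    using assms unfolding test_function_def by blast
  obtain B where B: "\<And>p. p \<in> K \<Longrightarrow> norm p \<le> B"
    using compact_imp_bounded[OF K(1)] by (auto simp: bounded_iff)
  define R where "R = \<bar>B\<bar> + 1"
  have outside: "p \<notin> K" if "R \<le> \<bar>fst p\<bar> \<or> R \<le> snd p" for p
  proof
    assume "p \<in> K"
    then show False
      using B[of p] norm_fst_le[of "fst p" "snd p"] norm_snd_le[of "snd p" "fst p"] that
      unfolding R_def by auto
  qed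
  have pd0: "pd_x \<phi> p = 0 \<and> pd_t \<phi> p = 0" if p: "p \<in> half_plane" "p \<notin> K" for p
  proof -
    have "open (- K)" using compact_imp_closed[OF K(1)] by (rule open_Compl)
    then obtain d where d: "0 < d" "ball p d \<subseteq> - K"
      using p(2) by (meson ComplI open_contains_ball)
    have "(\<phi> has_derivative (\<lambda>h. fst h * 0 + snd h * 0)) (at p within half_plane)"
    proof (rule has_derivative_transform_within[OF _ d(1) p(1)])
      show "((\<lambda>_. 0) has_derivative (\<lambda>h. fst h * 0 + snd h * 0)) (at p within half_plane)"
        by simp
      show "0 = \<phi> q" if "q \<in> half_plane" "dist q p < d" for q
      proof -
        have "q \<notin> K" using d(2) that(2) by (auto simp: dist_commute)
        then show ?thesis using K(2) that(1) by simp
      qed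
    qed
    then show ?thesis using pd_eqI[OF p(1)] by blast
  qed
  show thesis
  proof (rule that[of R])
    show "cont_vanishing_beyond R \<phi>" "cont_vanishing_beyond R (pd_x \<phi>)"
      "cont_vanishing_beyond R (pd_t \<phi>)"
      using test_function_cont_pd[OF assms] outside pd0 K(2)
      by (auto simp: cont_vanishing_beyond_def R_def)
  qed
qed

text \<open>
  The derivative along a line parallel to the shock, one-sided at \<open>t = 0\<close> since \<open>\<phi>\<close> is controlled only for
  \<open>t \<ge> 0\<close>.
\<close>

lemma test_function_deriv_along_line:
  assumes "test_function \<phi>" "0 \<le> t"
  shows "((\<lambda>t. \<phi> (y + c * t, t)) has_real_derivative
           (pd_t \<phi> (y + c * t, t) + c * pd_x \<phi> (y + c * t, t))) (at t within {0..})"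
proof -
  have line: "((\<lambda>t. (y + c * t, t)) has_derivative (\<lambda>h. (c * h, h))) (at t within {0..})"
    by (auto intro!: derivative_eq_intros)
  have "(\<phi> has_derivative
          (\<lambda>h. fst h * pd_x \<phi> (y + c * t, t) + snd h * pd_t \<phi> (y + c * t, t)))
        (at (y + c * t, t) within (\<lambda>t. (y + c * t, t)) ` {0..})"
    by (rule has_derivative_subset[OF test_function_has_derivative]) (use assms in auto)
  from has_derivative_in_compose[OF line this] show ?thesis
    unfolding has_field_derivative_def
    by (rule has_derivative_eq_rhs) (auto simp: fun_eq_iff algebra_simps)
qed

lemma test_function_deriv_in_space:
  assumes "test_function \<phi>" "0 \<le> t"
  shows "((\<lambda>y. \<phi> (y + a, t)) has_real_derivative pd_x \<phi> (y + a, t)) (at y)"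
proof -
  have line: "((\<lambda>y. (y + a, t)) has_derivative (\<lambda>h. (h, 0))) (at y)"
    by (auto intro!: derivative_eq_intros)
  have "(\<phi> has_derivative (\<lambda>h. fst h * pd_x \<phi> (y + a, t) + snd h * pd_t \<phi> (y + a, t)))
        (at (y + a, t) within (\<lambda>y. (y + a, t)) ` UNIV)"
    by (rule has_derivative_subset[OF test_function_has_derivative]) (use assms in auto)
  from has_derivative_in_compose[OF line this] show ?thesis
    unfolding has_field_derivative_def
    by (rule has_derivative_eq_rhs) (auto simp: fun_eq_iff algebra_simps)
qed

section \<open>The line x = c t as an arc\<close>

lemma lipschitz_arc_line: "lipschitz_arc {0..} (\<lambda>t. (c * t, t))"
  unfolding lipschitz_arc_def
proof (intro conjI)
  have "bounded_linear (\<lambda>t::real. (c * t, t))"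
    by (intro bounded_linear_Pair bounded_linear_mult_right bounded_linear_ident)
  then show "\<exists>L. L-lipschitz_on {0..} (\<lambda>t. (c * t, t))"
    using bounded_linear.lipschitz_boundE by blast
  show "\<exists>\<gamma>'. homeomorphism {0..} ((\<lambda>t. (c * t, t)) ` {0..}) (\<lambda>t. (c * t, t)) \<gamma>'"
    by (rule exI[of _ snd])
       (auto simp: homeomorphism_def image_image intro!: continuous_intros)
qed (auto simp: is_interval_ci interior_Ici[of "-1"])

lemma velocity_line:
  assumes "0 \<le> s"
  shows "velocity {0..} (\<lambda>t. (c * t, t)) s = (c, 1)"
proof -
  have "((\<lambda>t. (c * t, t)) has_vector_derivative (c, 1)) (at s within {0..})"
    by (auto intro!: derivative_eq_intros simp: has_vector_derivative_def)
  moreover have "s islimpt {0..}"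
    unfolding islimpt_approachable_real using assms
    by (metis add.commute add_pos_nonneg atLeast_iff less_add_same_cancel1 dense
        dist_real_def abs_of_pos add_diff_cancel_left' less_imp_le less_irrefl)
  then have "at s within {0..} \<noteq> bot"
    by (simp add: trivial_limit_within)
  ultimately show ?thesis
    unfolding velocity_def by (rule vector_derivative_within[rotated])
qed

text \<open>
  The factor \<open>norm (velocity ...)\<close> of the arc length undoes the normalisation of the tangent, leaving
  the derivative in the direction \<open>(c, 1)\<close>.
\<close>

lemma tangential_derivative_line:
  assumes "test_function \<phi>" "0 \<le> s"
  shows "tangential_derivative {0..} (\<lambda>t. (c * t, t)) \<phi> s * norm (velocity {0..} (\<lambda>t. (c * t, t)) s)
       = pd_t \<phi> (c * s, s) + c * pd_x \<phi> (c * s, s)"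
proof -
  let ?D = "frechet_derivative \<phi> (at (c * s, s) within half_plane)"
  have D: "?D = (\<lambda>h. fst h * pd_x \<phi> (c * s, s) + snd h * pd_t \<phi> (c * s, s))"
  proof (rule half_plane_has_derivative_unique)
    show "(c * s, s) \<in> half_plane" using assms by simp
    from test_function_has_derivative[OF assms(1) this]
    show "(\<phi> has_derivative (\<lambda>h. fst h * pd_x \<phi> (c * s, s) + snd h * pd_t \<phi> (c * s, s)))
            (at (c * s, s) within half_plane)" by simp
    then show "(\<phi> has_derivative ?D) (at (c * s, s) within half_plane)"
      using frechet_derivative_works differentiable_def by blast
  qed
  have n: "norm (c, 1::real) \<noteq> 0" by (simp add: zero_prod_def)
  have "?D (sgn (c, 1)) * norm (c, 1::real) = pd_t \<phi> (c * s, s) + c * pd_x \<phi> (c * s, s)"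
    unfolding D using n by (simp add: sgn_div_norm field_simps)
  then show ?thesis
    by (simp add: tangential_derivative_def velocity_line[OF assms(2)])
qed

section \<open>The three terms of the integral identity\<close>

text \<open>
  Integration by parts: the derivative \<open>\<phi>(c t, t) + t d/dt \<phi>(c t, t)\<close> of \<open>t \<phi>(c t, t)\<close> integrates
  to \<open>0\<close>, because this product vanishes at \<open>t = 0\<close> and for large \<open>t\<close>. The coefficient growing
  linearly from \<open>0\<close> is what leaves no boundary term at the origin.
\<close>

lemma line_term:
  fixes k c :: real
  assumes \<phi>: "test_function \<phi>"
  defines "h \<equiv> (\<lambda>s. k * s * tangential_derivative {0..} (\<lambda>t. (c * t, t)) \<phi> s)"
  shows "line_integrable {0..} (\<lambda>t. (c * t, t)) h"
    and "line_integral {0..} (\<lambda>t. (c * t, t)) h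
           = - k * (\<integral>t. indicator {0..} t * \<phi> (c * t, t) \<partial>lborel)"
proof -
  obtain R where R: "cont_vanishing_beyond R \<phi>" "cont_vanishing_beyond R (pd_x \<phi>)"
      "cont_vanishing_beyond R (pd_t \<phi>)"
    using test_function_vanishing_beyond[OF \<phi>] .
  define D where "D t = pd_t \<phi> (c * t, t) + c * pd_x \<phi> (c * t, t)" for t
  have D: "((\<lambda>t. \<phi> (c * t, t)) has_real_derivative D t) (at t within {0..})" if "0 \<le> t" for t
    using test_function_deriv_along_line[OF \<phi> that, of 0 c] by (simp add: D_def)
  have cont: "continuous_on {0..} (\<lambda>t. \<phi> (c * t, t))" "continuous_on {0..} D"
    using R[THEN cont_vanishing_beyond_along_line, of 0 c]
    by (auto simp: D_def intro!: continuous_intros)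
  let ?\<Phi> = "\<integral>t. indicator {0..} t * \<phi> (c * t, t) \<partial>lborel"
  have "has_bochner_integral lborel
          (\<lambda>t. indicator {0..} t * (\<phi> (c * t, t) + t * D t)) (- (0 * \<phi> (c * 0, 0)))"
  proof (rule half_line_integral_deriv)
    show "0 \<le> R" using R(1) by (simp add: cont_vanishing_beyond_def)
    show "((\<lambda>t. t * \<phi> (c * t, t)) has_real_derivative (\<phi> (c * t, t) + t * D t)) (at t within {0..})"
      if "0 \<le> t" for t
      using D[OF that] by (auto intro!: derivative_eq_intros)
    show "continuous_on {0..} (\<lambda>t. \<phi> (c * t, t) + t * D t)"
      using cont by (intro continuous_intros)
    show "t * \<phi> (c * t, t) = 0 \<and> \<phi> (c * t, t) + t * D t = 0" if "R \<le> t" for t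
      using R that by (auto simp: D_def cont_vanishing_beyond_def)
  qed
  moreover have "has_bochner_integral lborel (\<lambda>t. indicator {0..} t * \<phi> (c * t, t)) ?\<Phi>"
    using cont_vanishing_beyond_integrable_along_line[OF R(1)] by (rule has_bochner_integral_integrable)
  ultimately have "has_bochner_integral lborel
      (\<lambda>t. k * (indicator {0..} t * (\<phi> (c * t, t) + t * D t) - indicator {0..} t * \<phi> (c * t, t)))
      (k * (- (0 * \<phi> (c * 0, 0)) - ?\<Phi>))"
    by (intro has_bochner_integral_mult_right has_bochner_integral_diff)
  moreover have "(\<lambda>t. k * (indicator {0..} t * (\<phi> (c * t, t) + t * D t)
                     - indicator {0..} t * \<phi> (c * t, t)))
      = (\<lambda>s. indicator {0..} s *\<^sub>R (h s * norm (velocity {0..} (\<lambda>t. (c * t, t)) s)))"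
  proof
    fix s
    show "k * (indicator {0..} s * (\<phi> (c * s, s) + s * D s) - indicator {0..} s * \<phi> (c * s, s))
      = indicator {0..} s *\<^sub>R (h s * norm (velocity {0..} (\<lambda>t. (c * t, t)) s))"
      using tangential_derivative_line[OF \<phi>, of s c]
      by (cases "0 \<le> s") (auto simp: h_def D_def algebra_simps)
  qed
  ultimately have "has_bochner_integral lebesgue
      (\<lambda>s. indicator {0..} s *\<^sub>R (h s * norm (velocity {0..} (\<lambda>t. (c * t, t)) s))) (- k * ?\<Phi>)"
    by (intro has_bochner_integral_lebesgueI) simp
  then show "line_integrable {0..} (\<lambda>t. (c * t, t)) h"
    and "line_integral {0..} (\<lambda>t. (c * t, t)) h = - k * ?\<Phi>"
    by (auto simp: line_integrable_def line_integral_def set_integrable_def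
        set_lebesgue_integral_def has_bochner_integral_iff)
qed

lemma initial_term:
  assumes \<phi>: "test_function \<phi>" and W0: "two_state W0 w1 w2"
  shows "integrable lebesgue (\<lambda>x. W0 x * \<phi> (x, 0))"
    and "(LINT x|lebesgue. W0 x * \<phi> (x, 0)) = (\<integral>x. W0 x * \<phi> (x, 0) \<partial>lborel)"
proof -
  obtain R where R: "cont_vanishing_beyond R \<phi>"
    using test_function_vanishing_beyond[OF \<phi>] by blast
  have "integrable lborel (\<lambda>x. W0 x * \<phi> (x, 0))"
  proof (rule two_state_integrable[OF W0])
    show "continuous_on UNIV (\<lambda>x. \<phi> (x, 0))"
      using cont_vanishing_beyond_in_space[OF R, of 0 0] by simp
    show "\<phi> (y, 0) = 0" if "R \<le> \<bar>y\<bar>" for y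
      using R that by (simp add: cont_vanishing_beyond_def)
  qed
  then have "has_bochner_integral lborel (\<lambda>x. W0 x * \<phi> (x, 0)) (\<integral>x. W0 x * \<phi> (x, 0) \<partial>lborel)"
    by (rule has_bochner_integral_integrable)
  then have "has_bochner_integral lebesgue (\<lambda>x. W0 x * \<phi> (x, 0)) (\<integral>x. W0 x * \<phi> (x, 0) \<partial>lborel)"
    by (rule has_bochner_integral_lebesgueI)
  then show "integrable lebesgue (\<lambda>x. W0 x * \<phi> (x, 0))"
    and "(LINT x|lebesgue. W0 x * \<phi> (x, 0)) = (\<integral>x. W0 x * \<phi> (x, 0) \<partial>lborel)"
    by (auto simp: has_bochner_integral_iff)
qed

lemma bulk_integrable:
  assumes \<phi>: "test_function \<phi>" and W0: "two_state W0 w1 w2" and F0: "two_state F0 F1 F2"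
  shows "set_integrable lebesgue half_plane
           (\<lambda>p. W0 (fst p - c * snd p) * pd_t \<phi> p + F0 (fst p - c * snd p) * pd_x \<phi> p)"
proof -
  obtain R where R: "cont_vanishing_beyond R \<phi>" "cont_vanishing_beyond R (pd_x \<phi>)"
      "cont_vanishing_beyond R (pd_t \<phi>)"
    using test_function_vanishing_beyond[OF \<phi>] .
  have "integrable lborel (\<lambda>p. indicator half_plane p * (W0 (fst p - c * snd p) * pd_t \<phi> p)
          + indicator half_plane p * (F0 (fst p - c * snd p) * pd_x \<phi> p))"
    by (intro Bochner_Integration.integrable_add cont_vanishing_beyond_integrable[OF R(2)]
        cont_vanishing_beyond_integrable[OF R(3)]
        travelling_wave_borel_measurable[OF W0] travelling_wave_borel_measurable[OF F0]
        travelling_wave_bounded[OF W0] travelling_wave_bounded[OF F0])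
  then have "integrable lborel (\<lambda>p. indicator half_plane p *\<^sub>R
      (W0 (fst p - c * snd p) * pd_t \<phi> p + F0 (fst p - c * snd p) * pd_x \<phi> p))"
    by (simp add: algebra_simps)
  then show ?thesis
    unfolding set_integrable_def by (subst integrable_completion) auto
qed

text \<open>
  The contribution of the density, which is transported along the lines \<open>y = const\<close>: Fubini makes \<open>t\<close> the inner
  variable, and on each line \<open>y = const\<close> the integrand is \<open>W0 y\<close> times a total \<open>t\<close>-derivative.
\<close>

lemma transport_integral:
  fixes c :: real
  assumes \<phi>: "test_function \<phi>" and W0: "two_state W0 w1 w2"
  defines "J \<equiv> (\<lambda>t. \<integral>y. indicator half_plane (y, t) *
      (W0 y * (pd_t \<phi> (y + c * t, t) + c * pd_x \<phi> (y + c * t, t))) \<partial>lborel)"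
  shows "has_bochner_integral lborel J (- (\<integral>y. W0 y * \<phi> (y, 0) \<partial>lborel))"
proof -
  obtain R where R: "cont_vanishing_beyond R \<phi>" "cont_vanishing_beyond R (pd_x \<phi>)"
      "cont_vanishing_beyond R (pd_t \<phi>)"
    using test_function_vanishing_beyond[OF \<phi>] .
  define D where "D y t = pd_t \<phi> (y + c * t, t) + c * pd_x \<phi> (y + c * t, t)" for y t
  define R' where "R' = R + \<bar>c\<bar> * R"
  note shifted = R[THEN cont_vanishing_beyond_shift, of c, folded R'_def]
  have D: "cont_vanishing_beyond R' (\<lambda>p. D (fst p) (snd p))"
    using shifted(2,3)
    by (auto simp: cont_vanishing_beyond_def D_def case_prod_unfold intro!: continuous_intros)
  have "(\<lambda>p. W0 (fst p)) \<in> borel_measurable (borel :: (real \<times> real) measure)"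
    "bounded (range (\<lambda>p :: real \<times> real. W0 (fst p)))"
    using travelling_wave_borel_measurable[OF W0, of 0] travelling_wave_bounded[OF W0, of 0] by auto
  from cont_vanishing_beyond_integrable[OF D this]
  have int: "integrable (lborel \<Otimes>\<^sub>M lborel)
      (\<lambda>(y, t). indicator half_plane (y, t) * (W0 y * D y t))"
    by (simp add: lborel_prod case_prod_unfold)
  have "(\<integral>t. indicator half_plane (y, t) * (W0 y * D y t) \<partial>lborel) = - (W0 y * \<phi> (y, 0))" for y
  proof -
    have "has_bochner_integral lborel (\<lambda>t. indicator {0..} t * D y t) (- \<phi> (y + c * 0, 0))"
    proof (rule half_line_integral_deriv[of R'])
      show "0 \<le> R'" using D by (simp add: cont_vanishing_beyond_def)
      show "((\<lambda>t. \<phi> (y + c * t, t)) has_real_derivative D y t) (at t within {0..})" if "0 \<le> t" for t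
        using test_function_deriv_along_line[OF \<phi> that] by (simp add: D_def)
      show "continuous_on {0..} (D y)"
        using R[THEN cont_vanishing_beyond_along_line]
        by (auto simp: D_def intro!: continuous_intros)
      show "\<phi> (y + c * t, t) = 0 \<and> D y t = 0" if "R' \<le> t" for t
        using that shifted(1) D by (auto simp: cont_vanishing_beyond_def)
    qed
    from has_bochner_integral_mult_right[OF this, of "W0 y"]
    have "(\<integral>t. W0 y * (indicator {0..} t * D y t) \<partial>lborel) = - (W0 y * \<phi> (y, 0))"
      by (simp add: has_bochner_integral_iff)
    moreover have "(\<lambda>t. W0 y * (indicator {0..} t * D y t))
        = (\<lambda>t. indicator half_plane (y, t) * (W0 y * D y t))"
      by (auto simp: indicator_def)
    ultimately show ?thesis by simp
  qed
  with lborel_pair.Fubini_integral[OF int] lborel_pair.integrable_snd[OF int]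
  show ?thesis
    by (simp add: has_bochner_integral_iff J_def D_def)
qed

text \<open>
  At a fixed time, the translation \<open>x = y + c t\<close> turns the integrand into the transported density
  plus the relative flux \<open>F0 - c W0\<close> times \<open>\<phi>\<^sub>x\<close>, and the latter sees only the jump.
\<close>

lemma slice_integral:
  assumes \<phi>: "test_function \<phi>" and W0: "two_state W0 w1 w2" and F0: "two_state F0 F1 F2"
    and t: "0 \<le> t"
  shows "(LINT x|lebesgue. W0 (x - c * t) * pd_t \<phi> (x, t) + F0 (x - c * t) * pd_x \<phi> (x, t))
       = (\<integral>y. W0 y * (pd_t \<phi> (y + c * t, t) + c * pd_x \<phi> (y + c * t, t)) \<partial>lborel)
         + (c * (w2 - w1) - (F2 - F1)) * \<phi> (c * t, t)" (is "(LINT x|lebesgue. ?N x) = _")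
proof -
  obtain R where R: "cont_vanishing_beyond R \<phi>" "cont_vanishing_beyond R (pd_x \<phi>)"
      "cont_vanishing_beyond R (pd_t \<phi>)"
    using test_function_vanishing_beyond[OF \<phi>] .
  define R' where "R' = R + \<bar>c\<bar> * R"
  note shifted = R[THEN cont_vanishing_beyond_shift, of c, folded R'_def]
  have van: "\<phi> (y + c * t, t) = 0 \<and> pd_x \<phi> (y + c * t, t) = 0 \<and> pd_t \<phi> (y + c * t, t) = 0"
    if "R' \<le> \<bar>y\<bar>" for y
    using that t shifted by (auto simp: cont_vanishing_beyond_def)
  note cont = R[THEN cont_vanishing_beyond_in_space, OF t]
  have [measurable]: "W0 \<in> borel_measurable borel" "F0 \<in> borel_measurable borel"
    using W0 F0 two_state_borel_measurable by blast+
  have [measurable]: "(\<lambda>x. pd_x \<phi> (x, t)) \<in> borel_measurable borel"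
    "(\<lambda>x. pd_t \<phi> (x, t)) \<in> borel_measurable borel"
    using cont(2,3)[of 0] by (auto intro: borel_measurable_continuous_onI)
  have "(LINT x|lebesgue. ?N x) = (\<integral>x. ?N x \<partial>lborel)"
    by (rule integral_completion) measurable
  also have "\<dots> = (\<integral>y. ?N (y + c * t) \<partial>lborel)"
    by (subst lborel_integral_real_affine[where c = 1 and t = "c * t"]) (simp_all add: add.commute)
  also have "\<dots> = (\<integral>y. W0 y * (pd_t \<phi> (y + c * t, t) + c * pd_x \<phi> (y + c * t, t))
                      + (F0 y - c * W0 y) * pd_x \<phi> (y + c * t, t) \<partial>lborel)"
    by (simp add: algebra_simps)
  also have "\<dots> = (\<integral>y. W0 y * (pd_t \<phi> (y + c * t, t) + c * pd_x \<phi> (y + c * t, t)) \<partial>lborel)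
                  + (\<integral>y. (F0 y - c * W0 y) * pd_x \<phi> (y + c * t, t) \<partial>lborel)"
    by (intro Bochner_Integration.integral_add
        two_state_integrable[OF W0, where R = R']
        two_state_integrable[OF two_state_diff_scaled[OF W0 F0], where R = R']
        continuous_intros cont) (use van in auto)
  also have "(\<integral>y. (F0 y - c * W0 y) * pd_x \<phi> (y + c * t, t) \<partial>lborel)
      = ((F1 - c * w1) - (F2 - c * w2)) * \<phi> (0 + c * t, t)"
  proof (rule has_bochner_integral_integral_eq,
         rule two_state_integral_deriv[OF two_state_diff_scaled[OF W0 F0], where R = R'])
    show "0 \<le> R'" using shifted(1) by (simp add: cont_vanishing_beyond_def)
  qed (use test_function_deriv_in_space[OF \<phi> t] cont van in auto)
  finally show ?thesis by (simp add: algebra_simps)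
qed

lemma bulk_term:
  assumes \<phi>: "test_function \<phi>" and W0: "two_state W0 w1 w2" and F0: "two_state F0 F1 F2"
  shows "(LINT t:{0..}|lebesgue. LINT x|lebesgue.
            W0 (x - c * t) * pd_t \<phi> (x, t) + F0 (x - c * t) * pd_x \<phi> (x, t))
       = (c * (w2 - w1) - (F2 - F1)) * (\<integral>t. indicator {0..} t * \<phi> (c * t, t) \<partial>lborel)
         - (\<integral>y. W0 y * \<phi> (y, 0) \<partial>lborel)" (is "_ = ?k * ?\<Phi> - ?I")
proof -
  obtain R where R: "cont_vanishing_beyond R \<phi>"
    using test_function_vanishing_beyond[OF \<phi>] by blast
  let ?J = "\<lambda>t. \<integral>y. indicator half_plane (y, t) *
      (W0 y * (pd_t \<phi> (y + c * t, t) + c * pd_x \<phi> (y + c * t, t))) \<partial>lborel"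
  have "has_bochner_integral lborel (\<lambda>t. ?J t + ?k * (indicator {0..} t * \<phi> (c * t, t)))
          (- ?I + ?k * ?\<Phi>)"
    by (intro has_bochner_integral_add has_bochner_integral_mult_right transport_integral[OF \<phi> W0]
        has_bochner_integral_integrable cont_vanishing_beyond_integrable_along_line[OF R])
  moreover have "?J t + ?k * (indicator {0..} t * \<phi> (c * t, t))
      = indicator {0..} t *\<^sub>R (LINT x|lebesgue.
            W0 (x - c * t) * pd_t \<phi> (x, t) + F0 (x - c * t) * pd_x \<phi> (x, t))" for t
    using slice_integral[OF \<phi> W0 F0, of t c] by (cases "0 \<le> t") auto
  ultimately show ?thesis
    using has_bochner_integral_lebesgueI
    by (auto simp: set_lebesgue_integral_def has_bochner_integral_iff)
qed

section \<open>Delta shocks travelling at an arbitrary speed\<close>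

text \<open>
  The defect of the step and the contribution of the delta function carry the same factor
  \<open>c [W] - [F]\<close> with opposite signs.
\<close>

lemma weak_identity_line:
  assumes \<phi>: "test_function \<phi>" and W0: "two_state W0 w1 w2" and F0: "two_state F0 F1 F2"
  shows "weak_identity {()} (\<lambda>_. {0..}) (\<lambda>_ t. (c * t, t))
           (\<lambda>(x, t). W0 (x - c * t)) (\<lambda>(x, t). F0 (x - c * t))
           (\<lambda>_ (x, t). (c * (w2 - w1) - (F2 - F1)) * t) W0 \<phi>"
proof -
  define k where "k = c * (w2 - w1) - (F2 - F1)"
  show ?thesis
    unfolding weak_identity_def k_def[symmetric]
    using bulk_integrable[OF \<phi> W0 F0, of c] line_term[OF \<phi>, where k = k and c = c]
      initial_term[OF \<phi> W0] bulk_term[OF \<phi> W0 F0, of c, folded k_def]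
    by (simp add: case_prod_unfold)
qed

text \<open>
  Each component carries its own delta function, which cancels the Rankine-Hugoniot defect of its
  equation.
\<close>

lemma delta_shock_every_speed:
  assumes U0: "two_state U0 u1 u2" and V0: "two_state V0 v1 v2"
  shows "generalized_delta_shock_on_line f g U0 V0 c
           (\<lambda>(x, t). U0 (x - c * t)) (\<lambda>t. (c * (u2 - u1) - (f (u2, v2) - f (u1, v1))) * t)
           (\<lambda>(x, t). V0 (x - c * t)) (\<lambda>t. (c * (v2 - v1) - (g (u2, v2) - g (u1, v1))) * t)"
proof -
  have adm: "(\<lambda>(x, t). s (x - c * t)) \<in> borel_measurable (lebesgue_on half_plane)
      \<and> bounded ((\<lambda>(x, t). s (x - c * t)) ` half_plane)" if "two_state s a b" for s a b
  proof
    show "(\<lambda>(x, t). s (x - c * t)) \<in> borel_measurable (lebesgue_on half_plane)"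
      using travelling_wave_borel_measurable[OF that, of c]
      by (intro measurable_restrict_space1 measurable_completion) (simp add: case_prod_unfold)
    show "bounded ((\<lambda>(x, t). s (x - c * t)) ` half_plane)"
      by (rule bounded_subset[OF travelling_wave_bounded[OF that, of c]])
         (auto simp: case_prod_unfold)
  qed
  have cont: "continuous_on A (\<lambda>(x, t). k * t)" for A :: "(real \<times> real) set" and k :: real
    unfolding case_prod_unfold by (intro continuous_intros)
  have flux: "(\<lambda>p. h (case p of (x, t) \<Rightarrow> U0 (x - c * t), case p of (x, t) \<Rightarrow> V0 (x - c * t)))
      = (\<lambda>(x, t). h (U0 (x - c * t), V0 (x - c * t)))" for h :: "real \<times> real \<Rightarrow> real"
    by auto
  show ?thesis
    unfolding generalized_delta_shock_on_line_def generalized_delta_shock_def flux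
    using adm[OF U0] adm[OF V0] cont lipschitz_arc_line
      weak_identity_line[OF _ U0 two_state_comp2[OF U0 V0]]
      weak_identity_line[OF _ V0 two_state_comp2[OF U0 V0]]
    by auto
qed

theorem theorem1p2:
  fixes f g :: "real \<times> real \<Rightarrow> real"
    and U0 V0 :: "real \<Rightarrow> real"
    and u1 u2 v1 v2 :: real
  assumes "\<And>x. x < 0 \<Longrightarrow> U0 x = u1" and "\<And>x. x > 0 \<Longrightarrow> U0 x = u2"
    and "\<And>x. x < 0 \<Longrightarrow> V0 x = v1" and "\<And>x. x > 0 \<Longrightarrow> V0 x = v2"
  shows "(u1 \<noteq> u2 \<longrightarrow>
           (let c = (f (u2, v2) - f (u1, v1)) / (u2 - u1);
                \<beta> = (\<lambda>t. (c * (v2 - v1) - (g (u2, v2) - g (u1, v1))) * t)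
            in generalized_delta_shock_on_line f g U0 V0 c
                 (\<lambda>(x, t). U0 (x - c * t)) (\<lambda>t. 0)
                 (\<lambda>(x, t). V0 (x - c * t)) \<beta>)) \<and>
         (v1 \<noteq> v2 \<longrightarrow>
           (let c = (g (u2, v2) - g (u1, v1)) / (v2 - v1);
                \<alpha> = (\<lambda>t. (c * (u2 - u1) - (f (u2, v2) - f (u1, v1))) * t)
            in generalized_delta_shock_on_line f g U0 V0 c
                 (\<lambda>(x, t). U0 (x - c * t)) \<alpha>
                 (\<lambda>(x, t). V0 (x - c * t)) (\<lambda>t. 0)))"
proof -
  have U0: "two_state U0 u1 u2" and V0: "two_state V0 v1 v2"
    using assms by (auto simp: two_state_def)
  show ?thesis
    unfolding Let_def
  proof (intro conjI impI)
    assume "u1 \<noteq> u2"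
    then show "generalized_delta_shock_on_line f g U0 V0 ((f (u2, v2) - f (u1, v1)) / (u2 - u1))
        (\<lambda>(x, t). U0 (x - (f (u2, v2) - f (u1, v1)) / (u2 - u1) * t)) (\<lambda>t. 0)
        (\<lambda>(x, t). V0 (x - (f (u2, v2) - f (u1, v1)) / (u2 - u1) * t))
        (\<lambda>t. ((f (u2, v2) - f (u1, v1)) / (u2 - u1) * (v2 - v1) - (g (u2, v2) - g (u1, v1))) * t)"
      using delta_shock_every_speed[OF U0 V0, of f g "(f (u2, v2) - f (u1, v1)) / (u2 - u1)"]
      by simp
  next
    assume "v1 \<noteq> v2"
    then show "generalized_delta_shock_on_line f g U0 V0 ((g (u2, v2) - g (u1, v1)) / (v2 - v1))
        (\<lambda>(x, t). U0 (x - (g (u2, v2) - g (u1, v1)) / (v2 - v1) * t))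
        (\<lambda>t. ((g (u2, v2) - g (u1, v1)) / (v2 - v1) * (u2 - u1) - (f (u2, v2) - f (u1, v1))) * t)
        (\<lambda>(x, t). V0 (x - (g (u2, v2) - g (u1, v1)) / (v2 - v1) * t)) (\<lambda>t. 0)"
      using delta_shock_every_speed[OF U0 V0, of f g "(g (u2, v2) - g (u1, v1)) / (v2 - v1)"]
      by simp
  qed
qed

end
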